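(* Let $T$ be a path-connected compact Hausdorff space, let $B=C(T)$ be the ring of all real-valued continuous functions on $T$, let $\Delta$ be any set, and for each $\delta\in\Delta$ let $n_\delta\in\mathbb{N}$ be any natural number with $n_\delta>1$. Let $$A=B[x_\delta:\delta\in\Delta]/(x_\delta^{n_\delta}:\delta\in\Delta).$$ Then $A$ cannot be embedded into any function ring over a field of characteristic zero, yet $\mathrm{Max}(A)$ is a path-connected compact Hausdorff space with $|\mathrm{Max}(A)|>1$.
   Context: $\mathrm{Max}(A)$ is the set of maximal ideals of $A$ with the Zariski topology. A function ring over a field $F$ is a ring of $F$-valued functions on a set with pointwise operations; $A$ embeds into it if $A$ is isomorphic to one of its subrings.
   Formalization: T is taken nonempty; non-embeddability is claimed only for nonempty Δ (if Δ is empty, A=C(T) is itself a function ring over the reals), and |Max(A)|>1 only when T has at least two points (if T is a point, A is local). *)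

theory Defs
  imports "HOL-Algebra.Algebra" "HOL-Analysis.Analysis"
begin

section \<open>Rings of functions\<close>

text \<open>Elements are extensional (\<open>undefined\<close> off the underlying set), so that a function on the
  set is represented by exactly one HOL function.\<close>

definition continuous_fun_ring :: "'t topology \<Rightarrow> ('t \<Rightarrow> real) ring" where
  "continuous_fun_ring T =
    \<lparr>carrier = {f \<in> extensional (topspace T). continuous_map T euclideanreal f},
     monoid.mult = (\<lambda>f g. \<lambda>t\<in>topspace T. f t * g t),
     monoid.one = (\<lambda>t\<in>topspace T. 1),
     ring.zero = (\<lambda>t\<in>topspace T. 0),
     ring.add = (\<lambda>f g. \<lambda>t\<in>topspace T. f t + g t)\<rparr>"

text \<open>Not necessarily all functions from \<open>Y\<close> to \<open>F\<close>: any ring of such functions.\<close>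

definition function_ring :: "('f, 'm) ring_scheme \<Rightarrow> 'x set \<Rightarrow> ('x \<Rightarrow> 'f) ring \<Rightarrow> bool" where
  "function_ring F Y S \<longleftrightarrow>
    ring S \<and>
    carrier S \<subseteq> Y \<rightarrow>\<^sub>E carrier F \<and>
    \<zero>\<^bsub>S\<^esub> = (\<lambda>x\<in>Y. \<zero>\<^bsub>F\<^esub>) \<and>
    \<one>\<^bsub>S\<^esub> = (\<lambda>x\<in>Y. \<one>\<^bsub>F\<^esub>) \<and>
    (\<forall>f\<in>carrier S. \<forall>g\<in>carrier S.
       f \<oplus>\<^bsub>S\<^esub> g = (\<lambda>x\<in>Y. f x \<oplus>\<^bsub>F\<^esub> g x) \<and>
       f \<otimes>\<^bsub>S\<^esub> g = (\<lambda>x\<in>Y. f x \<otimes>\<^bsub>F\<^esub> g x))"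

definition ring_embeds :: "('a, 'm) ring_scheme \<Rightarrow> ('b, 'n) ring_scheme \<Rightarrow> bool" where
  "ring_embeds A S \<longleftrightarrow> (\<exists>K. subring K S \<and> A \<simeq> S\<lparr>carrier := K\<rparr>)"

definition char_zero :: "('f, 'm) ring_scheme \<Rightarrow> bool" where
  "char_zero F \<longleftrightarrow> (\<forall>k::nat. 0 < k \<longrightarrow> add_pow F k \<one>\<^bsub>F\<^esub> \<noteq> \<zero>\<^bsub>F\<^esub>)"


section \<open>Polynomial rings in an arbitrary set of variables\<close>

text \<open>The library's indexed polynomials (coefficient functions on multisets of variables) come
  with addition and with multiplication by one variable only; the product here is the
  convolution, the sum being over the finitely many submultisets of \<open>m\<close>.\<close>

definition (in ring) indexed_mult ::
    "('i multiset \<Rightarrow> 'a) \<Rightarrow> ('i multiset \<Rightarrow> 'a) \<Rightarrow> 'i multiset \<Rightarrow> 'a" where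
  "indexed_mult P Q = (\<lambda>m. \<Oplus>a\<in>{a. a \<subseteq># m}. P a \<otimes> Q (m - a))"

definition indexed_poly_ring ::
    "('a, 'm) ring_scheme \<Rightarrow> 'i set \<Rightarrow> ('i multiset \<Rightarrow> 'a) ring" where
  "indexed_poly_ring R I =
    \<lparr>carrier = ring.indexed_pset R I (carrier R),
     monoid.mult = ring.indexed_mult R,
     monoid.one = ring.indexed_const R \<one>\<^bsub>R\<^esub>,
     ring.zero = ring.indexed_const R \<zero>\<^bsub>R\<^esub>,
     ring.add = ring.indexed_padd R\<rparr>"

definition truncated_poly_ring ::
    "('a, 'm) ring_scheme \<Rightarrow> 'i set \<Rightarrow> ('i \<Rightarrow> nat) \<Rightarrow> ('i multiset \<Rightarrow> 'a) set ring" where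
  "truncated_poly_ring R I n =
    (let P = indexed_poly_ring R I
     in P Quot (Idl\<^bsub>P\<^esub> ((\<lambda>i. ring.indexed_var R i [^]\<^bsub>P\<^esub> n i) ` I)))"


section \<open>The maximal spectrum\<close>

definition max_ideals :: "('a, 'm) ring_scheme \<Rightarrow> 'a set set" where
  "max_ideals A = {M. maximalideal M A}"

text \<open>Zariski topology: the closed sets are those of all maximal ideals containing a given set
  \<open>E\<close>, so the open sets are their complements.\<close>

definition max_spectrum :: "('a, 'm) ring_scheme \<Rightarrow> 'a set topology" where
  "max_spectrum A =
    topology (\<lambda>U. \<exists>E\<subseteq>carrier A. U = {M \<in> max_ideals A. \<not> E \<subseteq> M})"


section \<open>Well-definedness\<close>

lemma cring_continuous_fun_ring: "cring (continuous_fun_ring T)"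
proof (rule cringI)
  let ?C = "continuous_fun_ring T"
  show "abelian_group ?C"
  proof (rule abelian_groupI)
    fix f assume f: "f \<in> carrier ?C"
    show "\<exists>g\<in>carrier ?C. g \<oplus>\<^bsub>?C\<^esub> f = \<zero>\<^bsub>?C\<^esub>"
      using f by (intro bexI[where x = "\<lambda>t\<in>topspace T. - f t"])
        (auto simp: continuous_fun_ring_def fun_eq_iff extensional_def
          intro: continuous_map_eq[where f = "\<lambda>t. - f t"] continuous_intros)
  qed (auto simp: continuous_fun_ring_def fun_eq_iff extensional_def algebra_simps
        intro: continuous_map_eq[where f = "\<lambda>t. f t + g t" for f g :: "'a \<Rightarrow> real"]
               continuous_map_eq[where f = "\<lambda>t. 0::real"] continuous_map_add)
  show "comm_monoid ?C"
    by (rule comm_monoidI)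
      (auto simp: continuous_fun_ring_def fun_eq_iff extensional_def algebra_simps
        intro: continuous_map_eq[where f = "\<lambda>t. f t * g t" for f g :: "'a \<Rightarrow> real"]
               continuous_map_eq[where f = "\<lambda>t. 1::real"] continuous_map_real_mult)
qed (auto simp: continuous_fun_ring_def fun_eq_iff algebra_simps)

lemma finite_submultisets: "finite {a. a \<subseteq># m}"
proof (induction m)
  case empty
  then show ?case by simp
next
  case (add x m)
  have "{a. a \<subseteq># add_mset x m} \<subseteq> {a. a \<subseteq># m} \<union> add_mset x ` {a. a \<subseteq># m}"
  proof
    fix a assume "a \<in> {a. a \<subseteq># add_mset x m}"
    then have a: "a \<subseteq># add_mset x m" by simp
    show "a \<in> {a. a \<subseteq># m} \<union> add_mset x ` {a. a \<subseteq># m}"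
    proof (cases "x \<in># a")
      case True
      then obtain b where "a = add_mset x b" by (metis insert_DiffM)
      then show ?thesis using a by auto
    next
      case False
      then show ?thesis using a
        by (metis (no_types) UnCI add_mset_remove_trivial diff_single_trivial mem_Collect_eq
            subset_eq_diff_conv add_mset_add_single)
    qed
  qed
  then show ?case using add by (meson finite_UnI finite_imageI finite_subset)
qed

context cring
begin

lemma indexed_mult_in_carrier:
  "carrier_coeff P \<Longrightarrow> carrier_coeff Q \<Longrightarrow> carrier_coeff (indexed_mult P Q)"
  unfolding carrier_coeff_def indexed_mult_def by (auto intro!: finsum_closed)

lemma indexed_mult_commute:
  fixes P Q :: "'i multiset \<Rightarrow> 'a"
  assumes "carrier_coeff P" "carrier_coeff Q"
  shows "indexed_mult P Q = indexed_mult Q P"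
proof
  fix m :: "'i multiset"
  have bij: "bij_betw (\<lambda>a. m - a) {a. a \<subseteq># m} {a. a \<subseteq># m}"
    by (rule bij_betwI[where g = "\<lambda>a. m - a"]) (auto simp: multiset_eq_iff subseteq_mset_def)
  have "indexed_mult P Q m = (\<Oplus>a\<in>(\<lambda>a. m - a) ` {a. a \<subseteq># m}. P a \<otimes> Q (m - a))"
    using bij by (simp add: bij_betw_def indexed_mult_def)
  also have "\<dots> = (\<Oplus>a\<in>{a. a \<subseteq># m}. P (m - a) \<otimes> Q (m - (m - a)))"
    using assms bij by (intro finsum_reindex) (auto simp: bij_betw_def carrier_coeff_def)
  also have "\<dots> = indexed_mult Q P m"
    unfolding indexed_mult_def
  proof (rule finsum_cong')
    fix a assume "a \<in> {a. a \<subseteq># m}"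
    then have "m - (m - a) = a" by (auto simp: multiset_eq_iff subseteq_mset_def)
    then show "P (m - a) \<otimes> Q (m - (m - a)) = Q a \<otimes> P (m - a)"
      using assms by (simp add: carrier_coeff_def m_comm)
  qed (use assms in \<open>auto simp: carrier_coeff_def\<close>)
  finally show "indexed_mult P Q m = indexed_mult Q P m" .
qed

lemma indexed_mult_add:
  assumes "carrier_coeff P" "carrier_coeff P'" "carrier_coeff Q"
  shows "indexed_mult (P \<Oplus> P') Q = indexed_mult P Q \<Oplus> indexed_mult P' Q"
proof
  fix m
  have "indexed_mult (P \<Oplus> P') Q m = (\<Oplus>a\<in>{a. a \<subseteq># m}. P a \<otimes> Q (m - a) \<oplus> P' a \<otimes> Q (m - a))"
    unfolding indexed_mult_def
    using assms by (intro finsum_cong') (auto simp: carrier_coeff_def indexed_padd_def l_distr)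
  also have "\<dots> = (indexed_mult P Q \<Oplus> indexed_mult P' Q) m"
    unfolding indexed_padd_def indexed_mult_def
    using assms by (intro finsum_addf) (auto simp: carrier_coeff_def)
  finally show "indexed_mult (P \<Oplus> P') Q m = (indexed_mult P Q \<Oplus> indexed_mult P' Q) m" .
qed

lemma indexed_mult_const:
  assumes "k \<in> carrier R" "carrier_coeff Q"
  shows "indexed_mult (indexed_const k) Q = (\<lambda>m. k \<otimes> Q m)"
proof
  fix m
  have "indexed_mult (indexed_const k) Q m = (\<Oplus>a\<in>{a. a \<subseteq># m}. if {#} = a then k \<otimes> Q (m - a) else \<zero>)"
    unfolding indexed_mult_def
    using assms by (intro finsum_cong') (auto simp: carrier_coeff_def indexed_const_def)
  also have "\<dots> = k \<otimes> Q (m - {#})"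
    using assms finite_submultisets by (intro finsum_singleton) (auto simp: carrier_coeff_def)
  finally show "indexed_mult (indexed_const k) Q m = k \<otimes> Q m" by simp
qed

lemma indexed_mult_pmult:
  assumes "carrier_coeff P" "carrier_coeff Q"
  shows "indexed_mult (P \<Otimes> i) Q = indexed_mult P Q \<Otimes> i"
proof
  fix m
  have split: "indexed_mult (P \<Otimes> i) Q m = (\<Oplus>a\<in>{a. a \<subseteq># m \<and> i \<in># a}. (P \<Otimes> i) a \<otimes> Q (m - a))"
    unfolding indexed_mult_def
    using assms finite_submultisets
    by (intro add.finprod_mono_neutral_cong_left[symmetric])
      (auto simp: carrier_coeff_def indexed_pmult_def)
  show "indexed_mult (P \<Otimes> i) Q m = (indexed_mult P Q \<Otimes> i) m"
  proof (cases "i \<in># m")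
    case False
    then have "{a. a \<subseteq># m \<and> i \<in># a} = {}" by (auto dest: mset_subset_eqD)
    then have "indexed_mult (P \<Otimes> i) Q m = \<zero>" using split by (simp only: finsum_empty)
    then show ?thesis using False by (simp add: indexed_pmult_def)
  next
    case True
    then obtain m' where m: "m = add_mset i m'" by (metis insert_DiffM)
    have im: "{a. a \<subseteq># m \<and> i \<in># a} = add_mset i ` {a. a \<subseteq># m'}"
    proof (intro equalityI subsetI)
      fix a assume a: "a \<in> {a. a \<subseteq># m \<and> i \<in># a}"
      then obtain b where "a = add_mset i b" by (metis (no_types, lifting) insert_DiffM mem_Collect_eq)
      then show "a \<in> add_mset i ` {a. a \<subseteq># m'}" using a m by auto
    qed (use m in auto)
    have "(\<Oplus>a\<in>add_mset i ` {a. a \<subseteq># m'}. (P \<Otimes> i) a \<otimes> Q (m - a))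
        = (\<Oplus>a\<in>{a. a \<subseteq># m'}. (P \<Otimes> i) (add_mset i a) \<otimes> Q (m - add_mset i a))"
      using assms by (intro finsum_reindex) (auto simp: carrier_coeff_def indexed_pmult_def inj_on_def)
    also have "\<dots> = indexed_mult P Q m'"
      unfolding indexed_mult_def
      using assms m by (intro finsum_cong') (auto simp: carrier_coeff_def indexed_pmult_def)
    finally show ?thesis using split im m by (simp add: indexed_pmult_def)
  qed
qed

lemma smult_pset:
  assumes "k \<in> carrier R" "P \<in> ((carrier R)[\<X>\<^bsub>I\<^esub>])"
  shows "(\<lambda>m. k \<otimes> P m) \<in> ((carrier R)[\<X>\<^bsub>I\<^esub>])"
  using assms(2)
proof (induction)
  case (indexed_const c)
  have "(\<lambda>m. k \<otimes> indexed_const c m) = indexed_const (k \<otimes> c)"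
    using assms(1) by (auto simp: indexed_const_def)
  then show ?case using indexed_pset.indexed_const[of "k \<otimes> c" "carrier R" I] assms(1) indexed_const
    by (metis m_closed)
next
  case (indexed_padd P Q)
  have "(\<lambda>m. k \<otimes> (P \<Oplus> Q) m) = (\<lambda>m. k \<otimes> P m) \<Oplus> (\<lambda>m. k \<otimes> Q m)"
    using assms(1) indexed_padd(1,2)[THEN indexed_pset_in_carrier[OF subset_refl]]
    by (auto simp: indexed_padd_def carrier_coeff_def r_distr)
  then show ?case using indexed_padd by (simp add: indexed_pset.indexed_padd)
next
  case (indexed_pmult P i)
  have "(\<lambda>m. k \<otimes> (P \<Otimes> i) m) = (\<lambda>m. k \<otimes> P m) \<Otimes> i"
    using assms(1) by (auto simp: indexed_pmult_def)
  then show ?case using indexed_pmult by (simp add: indexed_pset.indexed_pmult)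
qed

lemma indexed_mult_pset:
  assumes "P \<in> ((carrier R)[\<X>\<^bsub>I\<^esub>])" "Q \<in> ((carrier R)[\<X>\<^bsub>I\<^esub>])"
  shows "indexed_mult P Q \<in> ((carrier R)[\<X>\<^bsub>I\<^esub>])"
  using assms
proof (induction)
  case (indexed_const k)
  then show ?case
    by (simp add: indexed_mult_const smult_pset indexed_pset_in_carrier[OF subset_refl])
next
  case (indexed_padd P P')
  then show ?case
    by (simp add: indexed_mult_add indexed_pset_in_carrier[OF subset_refl, where I = I] indexed_pset.indexed_padd)
next
  case (indexed_pmult P i)
  then show ?case
    by (simp add: indexed_mult_pmult indexed_pset_in_carrier[OF subset_refl, where I = I] indexed_pset.indexed_pmult)
qed

lemma indexed_mult_assoc:
  assumes "P \<in> ((carrier R)[\<X>\<^bsub>I\<^esub>])" "carrier_coeff Q" "carrier_coeff S"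
  shows "indexed_mult (indexed_mult P Q) S = indexed_mult P (indexed_mult Q S)"
  using assms(1)
proof (induction)
  case (indexed_const k)
  have "indexed_mult (\<lambda>m. k \<otimes> Q m) S = (\<lambda>m. k \<otimes> indexed_mult Q S m)"
  proof
    fix m
    have "indexed_mult (\<lambda>m. k \<otimes> Q m) S m = (\<Oplus>a\<in>{a. a \<subseteq># m}. k \<otimes> (Q a \<otimes> S (m - a)))"
      unfolding indexed_mult_def
      using assms indexed_const by (intro finsum_cong') (auto simp: carrier_coeff_def m_assoc)
    also have "\<dots> = k \<otimes> indexed_mult Q S m"
      unfolding indexed_mult_def
      using assms indexed_const finite_submultisets
      by (intro finsum_rdistr[symmetric]) (auto simp: carrier_coeff_def)
    finally show "indexed_mult (\<lambda>m. k \<otimes> Q m) S m = k \<otimes> indexed_mult Q S m" .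
  qed
  then show ?case
    using indexed_const assms by (simp add: indexed_mult_const indexed_mult_in_carrier)
next
  case (indexed_padd P P')
  note c = indexed_padd(1,2)[THEN indexed_pset_in_carrier[OF subset_refl]]
  have "indexed_mult (indexed_mult (P \<Oplus> P') Q) S = indexed_mult (indexed_mult P Q \<Oplus> indexed_mult P' Q) S"
    using c assms by (simp add: indexed_mult_add)
  also have "\<dots> = indexed_mult (indexed_mult P Q) S \<Oplus> indexed_mult (indexed_mult P' Q) S"
    using c assms by (intro indexed_mult_add indexed_mult_in_carrier)
  also have "\<dots> = indexed_mult P (indexed_mult Q S) \<Oplus> indexed_mult P' (indexed_mult Q S)"
    using indexed_padd by simp
  also have "\<dots> = indexed_mult (P \<Oplus> P') (indexed_mult Q S)"
    using c assms by (intro indexed_mult_add[symmetric] indexed_mult_in_carrier)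
  finally show ?case .
next
  case (indexed_pmult P i)
  note c = indexed_pmult(1)[THEN indexed_pset_in_carrier[OF subset_refl]]
  have "indexed_mult (indexed_mult (P \<Otimes> i) Q) S = indexed_mult (indexed_mult P Q \<Otimes> i) S"
    using c assms by (simp add: indexed_mult_pmult)
  also have "\<dots> = indexed_mult (indexed_mult P Q) S \<Otimes> i"
    using c assms by (intro indexed_mult_pmult indexed_mult_in_carrier)
  also have "\<dots> = indexed_mult P (indexed_mult Q S) \<Otimes> i"
    using indexed_pmult by simp
  also have "\<dots> = indexed_mult (P \<Otimes> i) (indexed_mult Q S)"
    using c assms by (intro indexed_mult_pmult[symmetric] indexed_mult_in_carrier)
  finally show ?case .
qed

lemma cring_indexed_poly_ring: "cring (indexed_poly_ring R I)"
proof (rule cringI)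
  let ?P = "indexed_poly_ring R I"
  note cc = indexed_pset_in_carrier[OF subset_refl, where I = I]
  show "abelian_group ?P"
  proof (rule abelian_groupI)
    fix P assume P: "P \<in> carrier ?P"
    have "(\<lambda>m. \<ominus> \<one> \<otimes> P m) \<Oplus> P = indexed_const \<zero>"
      using P cc[of P]
      by (auto simp: indexed_padd_def indexed_zero_def carrier_coeff_def indexed_poly_ring_def
          l_minus l_neg)
    then show "\<exists>Q\<in>carrier ?P. Q \<oplus>\<^bsub>?P\<^esub> P = \<zero>\<^bsub>?P\<^esub>"
      using P smult_pset[of "\<ominus> \<one>" P I]
      by (intro bexI[where x = "\<lambda>m. \<ominus> \<one> \<otimes> P m"]) (auto simp: indexed_poly_ring_def)
  next
    fix P Q S assume "P \<in> carrier ?P" "Q \<in> carrier ?P" "S \<in> carrier ?P"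
    then show "P \<oplus>\<^bsub>?P\<^esub> Q \<oplus>\<^bsub>?P\<^esub> S = P \<oplus>\<^bsub>?P\<^esub> (Q \<oplus>\<^bsub>?P\<^esub> S)"
      using cc[of P] cc[of Q] cc[of S]
      by (auto simp: indexed_poly_ring_def indexed_padd_def carrier_coeff_def a_assoc)
  next
    fix P Q assume "P \<in> carrier ?P" "Q \<in> carrier ?P"
    then show "P \<oplus>\<^bsub>?P\<^esub> Q = Q \<oplus>\<^bsub>?P\<^esub> P"
      using cc[of P] cc[of Q]
      by (auto simp: indexed_poly_ring_def indexed_padd_def carrier_coeff_def a_comm)
  qed (auto simp: indexed_poly_ring_def indexed_padd_zero cc
        intro: indexed_pset.intros)
  show "comm_monoid ?P"
  proof (rule comm_monoidI)
    fix P assume "P \<in> carrier ?P"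
    then show "\<one>\<^bsub>?P\<^esub> \<otimes>\<^bsub>?P\<^esub> P = P"
      using cc[of P] by (auto simp: indexed_poly_ring_def indexed_mult_const carrier_coeff_def)
  next
    fix P Q S assume "P \<in> carrier ?P" "Q \<in> carrier ?P" "S \<in> carrier ?P"
    then show "P \<otimes>\<^bsub>?P\<^esub> Q \<otimes>\<^bsub>?P\<^esub> S = P \<otimes>\<^bsub>?P\<^esub> (Q \<otimes>\<^bsub>?P\<^esub> S)"
      using indexed_mult_assoc[of P I Q S] cc by (simp add: indexed_poly_ring_def)
  next
    fix P Q assume "P \<in> carrier ?P" "Q \<in> carrier ?P"
    then show "P \<otimes>\<^bsub>?P\<^esub> Q = Q \<otimes>\<^bsub>?P\<^esub> P"
      using cc[of P] cc[of Q] by (simp add: indexed_poly_ring_def indexed_mult_commute[of P Q])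
  qed (auto simp: indexed_poly_ring_def indexed_mult_pset intro: indexed_pset.intros)
  fix P Q S assume "P \<in> carrier ?P" "Q \<in> carrier ?P" "S \<in> carrier ?P"
  then show "(P \<oplus>\<^bsub>?P\<^esub> Q) \<otimes>\<^bsub>?P\<^esub> S = P \<otimes>\<^bsub>?P\<^esub> S \<oplus>\<^bsub>?P\<^esub> Q \<otimes>\<^bsub>?P\<^esub> S"
    using indexed_mult_add[of P Q S] cc by (simp add: indexed_poly_ring_def)
qed

lemma indexed_var_in_poly_ring: "i \<in> I \<Longrightarrow> indexed_var i \<in> carrier (indexed_poly_ring R I)"
  by (auto simp: indexed_poly_ring_def indexed_var_def intro: indexed_pset.intros)

lemma cring_truncated_poly_ring: "cring (truncated_poly_ring R I n)"
proof -
  interpret P: cring "indexed_poly_ring R I" by (rule cring_indexed_poly_ring)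
  have "ideal (Idl\<^bsub>indexed_poly_ring R I\<^esub>
      ((\<lambda>i. indexed_var i [^]\<^bsub>indexed_poly_ring R I\<^esub> n i) ` I)) (indexed_poly_ring R I)"
    by (intro P.genideal_ideal) (auto intro: P.nat_pow_closed indexed_var_in_poly_ring)
  then show ?thesis
    unfolding truncated_poly_ring_def Let_def
    by (intro ideal.quotient_is_cring P.is_cring)
qed

lemma istopology_max_spectrum:
  "istopology (\<lambda>U. \<exists>E\<subseteq>carrier R. U = {M \<in> max_ideals R. \<not> E \<subseteq> M})"
  unfolding istopology_def
proof (intro conjI allI impI)
  fix U V
  assume "\<exists>E\<subseteq>carrier R. U = {M \<in> max_ideals R. \<not> E \<subseteq> M}"
    and "\<exists>E\<subseteq>carrier R. V = {M \<in> max_ideals R. \<not> E \<subseteq> M}"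
  then obtain D E where DE: "D \<subseteq> carrier R" "E \<subseteq> carrier R"
    and U: "U = {M \<in> max_ideals R. \<not> D \<subseteq> M}" and V: "V = {M \<in> max_ideals R. \<not> E \<subseteq> M}" by blast
  have prod: "x \<in> M \<or> y \<in> M"
    if M: "M \<in> max_ideals R" and "x \<in> carrier R" "y \<in> carrier R" "x \<otimes> y \<in> M" for M x y
  proof -
    from M have "maximalideal M R" by (simp add: max_ideals_def)
    then have "primeideal M R" by (rule maximalideal_prime)
    then show ?thesis using that(2-4) by (rule primeideal.I_prime)
  qed
  have prod': "x \<otimes> y \<in> M" if M: "M \<in> max_ideals R" and "x \<in> carrier R" "y \<in> carrier R"
    and "x \<in> M \<or> y \<in> M" for M x y
  proof -
    from M interpret maximalideal M R by (simp add: max_ideals_def)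
    show ?thesis using that I_l_closed I_r_closed by auto
  qed
  have "U \<inter> V = {M \<in> max_ideals R. \<not> (\<lambda>(x, y). x \<otimes> y) ` (D \<times> E) \<subseteq> M}"
    (is "?l = ?r")
  proof (intro equalityI subsetI)
    fix M assume "M \<in> ?l"
    then obtain x y where M: "M \<in> max_ideals R" "x \<in> D" "x \<notin> M" "y \<in> E" "y \<notin> M"
      unfolding U V by blast
    then have "x \<otimes> y \<notin> M" using prod[of M x y] DE by blast
    then show "M \<in> ?r" using M by force
  next
    fix M assume "M \<in> ?r"
    then obtain x y where M: "M \<in> max_ideals R" "x \<in> D" "y \<in> E" "x \<otimes> y \<notin> M"
      by (auto simp: image_subset_iff)
    then have "x \<notin> M" "y \<notin> M" using prod'[of M x y] DE by blast+
    then show "M \<in> ?l" unfolding U V using M by blast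
  qed
  moreover have "(\<lambda>(x, y). x \<otimes> y) ` (D \<times> E) \<subseteq> carrier R" using DE by auto
  ultimately show "\<exists>E\<subseteq>carrier R. U \<inter> V = {M \<in> max_ideals R. \<not> E \<subseteq> M}" by blast
next
  fix \<K> assume "\<forall>K\<in>\<K>. \<exists>E\<subseteq>carrier R. K = {M \<in> max_ideals R. \<not> E \<subseteq> M}"
  then obtain e where e: "\<And>K. K \<in> \<K> \<Longrightarrow> e K \<subseteq> carrier R \<and> K = {M \<in> max_ideals R. \<not> e K \<subseteq> M}"
    by metis
  have "\<Union>\<K> = {M \<in> max_ideals R. \<not> (\<Union>K\<in>\<K>. e K) \<subseteq> M}" using e by blast
  moreover have "(\<Union>K\<in>\<K>. e K) \<subseteq> carrier R" using e by blast
  ultimately show "\<exists>E\<subseteq>carrier R. \<Union>\<K> = {M \<in> max_ideals R. \<not> E \<subseteq> M}" by blast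
qed

lemma openin_max_spectrum:
  "openin (max_spectrum R) U \<longleftrightarrow> (\<exists>E\<subseteq>carrier R. U = {M \<in> max_ideals R. \<not> E \<subseteq> M})"
  unfolding max_spectrum_def using istopology_max_spectrum by (simp add: topology_inverse')

lemma topspace_max_spectrum: "topspace (max_spectrum R) = max_ideals R"
proof
  show "topspace (max_spectrum R) \<subseteq> max_ideals R"
    using openin_max_spectrum[of "topspace (max_spectrum R)"] by auto
  have "max_ideals R = {M \<in> max_ideals R. \<not> carrier R \<subseteq> M}"
    unfolding max_ideals_def
    by (auto dest: maximalideal.I_notcarr maximalideal.axioms(1) ideal.Icarr)
  then show "max_ideals R \<subseteq> topspace (max_spectrum R)"
    by (metis openin_max_spectrum openin_subset subset_refl)
qed

end

end

theory Submission
  imports Defs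
begin

text \<open>Two independent facts about \<open>A\<close> are at work.

  A ring of functions with values in a field has no nilpotent element except zero, because a
  nilpotent function takes nilpotent values (\<open>nilpotent_eq_zero_of_embeds\<close>). The class of a variable
  in \<open>A\<close> is nilpotent, and it is not zero: the relations \<open>x\<^sub>\<delta> ^ n\<^sub>\<delta> = 0\<close> generate an ideal whose
  members have no coefficient at a monomial with all exponents below the bounds
  (\<open>truncation_ideal_coeff\<close>), and a single variable is such a monomial as every bound exceeds one.

  Maximal ideals do not see nilpotent elements. All variables lie in every prime ideal of \<open>A\<close>, hence
  so does everything without constant term (\<open>const_coeff_kernel_in_prime\<close>), and the maximal ideals
  of \<open>A\<close> are those of \<open>C(T)\<close> pulled back along the constant coefficient. By the theorem of Gelfand
  and Kolmogorov the maximal ideals of \<open>C(T)\<close> are the vanishing ideals of the points of \<open>T\<close>. This is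
  proved directly for a ring that maps onto \<open>C(T)\<close> with a kernel contained in all maximal ideals: the
  map from points to ideals is a homeomorphism from \<open>T\<close> to the maximal spectrum
  (\<open>homeomorphic_map_point_ideal\<close>), along which every topological property of \<open>T\<close> is transported.\<close>

section \<open>Rings of functions with values in a domain are reduced\<close>

lemma (in domain) nat_pow_eq_zeroD:
  assumes "x \<in> carrier R" "x [^] (k::nat) = \<zero>"
  shows "x = \<zero>"
  using assms by (induction k) (auto dest: integral)

text \<open>Powers are taken pointwise, so each value of the image of a nilpotent element is a nilpotent
  element of \<open>F\<close>, hence zero; injectivity carries this back to \<open>A\<close>.\<close>

lemma nilpotent_eq_zero_of_embeds:
  fixes A :: "('a, 'm) ring_scheme" and S :: "('x \<Rightarrow> 'f) ring" and k :: nat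
  assumes F: "domain F" and S: "function_ring F Y S" and A: "ring A" "ring_embeds A S"
    and x: "x \<in> carrier A" "x [^]\<^bsub>A\<^esub> k = \<zero>\<^bsub>A\<^esub>"
  shows "x = \<zero>\<^bsub>A\<^esub>"
proof -
  interpret F: domain F by (rule F)
  interpret A: ring A by (rule A)
  interpret S: ring S using S by (simp add: function_ring_def)
  obtain K h where K: "subring K S" and h: "h \<in> ring_iso A (S\<lparr>carrier := K\<rparr>)"
    using A(2) by (auto simp: ring_embeds_def is_ring_iso_def)
  have KS: "K \<subseteq> carrier S" using K by (simp add: subringE(1))
  have hS: "h \<in> ring_hom A S"
    using h KS by (auto simp: ring_iso_def ring_hom_def)
  interpret h: ring_hom_ring A S h
    by (intro ring_hom_ringI2 A.ring_axioms S.ring_axioms hS)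
  have inj: "inj_on h (carrier A)"
    using h by (simp add: ring_iso_def bij_betw_def)
  have val: "h a y \<in> carrier F" if "a \<in> carrier A" "y \<in> Y" for a y
    using S h.hom_closed[OF that(1)] that(2) by (auto simp: function_ring_def)
  have pow: "h (x [^]\<^bsub>A\<^esub> j) y = h x y [^]\<^bsub>F\<^esub> j" if "y \<in> Y" for j :: nat and y
  proof (induction j)
    case 0
    then show ?case using S that by (simp add: function_ring_def)
  next
    case (Suc j)
    have "h (x [^]\<^bsub>A\<^esub> Suc j) = (\<lambda>y\<in>Y. h (x [^]\<^bsub>A\<^esub> j) y \<otimes>\<^bsub>F\<^esub> h x y)"
      using S x by (simp add: function_ring_def)
    then show ?case using Suc that by simp
  qed
  have zero: "h x y = \<zero>\<^bsub>F\<^esub>" if y: "y \<in> Y" for y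
  proof (rule F.nat_pow_eq_zeroD)
    show "h x y \<in> carrier F" using val x y by simp
    show "h x y [^]\<^bsub>F\<^esub> k = \<zero>\<^bsub>F\<^esub>"
      using pow[OF y, of k] S x y by (simp add: function_ring_def)
  qed
  have "h x \<in> Y \<rightarrow>\<^sub>E carrier F"
    using S h.hom_closed[OF x(1)] by (auto simp: function_ring_def)
  then have "h x = (\<lambda>y\<in>Y. \<zero>\<^bsub>F\<^esub>)"
    using zero by (auto simp: PiE_def extensional_def fun_eq_iff)
  then have "h x = h \<zero>\<^bsub>A\<^esub>"
    using S by (simp add: function_ring_def)
  then show ?thesis using inj_onD[OF inj _ x(1) A.zero_closed] by blast
qed


section \<open>Maximal ideals of a ring that surjects onto a ring of continuous functions\<close>

text \<open>The condition on the kernel says that it lies in the Jacobson radical, so that passing from \<open>R\<close>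
  to the quotient \<open>C(T)\<close> loses no maximal ideal. Evaluating \<open>e a\<close> at points of \<open>T\<close> then lets the
  classical arguments for \<open>C(T)\<close> be carried out in \<open>R\<close> itself.\<close>

locale continuous_fun_quotient = cring R
  for R :: "('a, 'm) ring_scheme" (structure) +
  fixes T :: "'t topology" and e :: "'a \<Rightarrow> 't \<Rightarrow> real"
  assumes compact: "compact_space T" and Hausdorff: "Hausdorff_space T"
    and hom: "e \<in> ring_hom R (continuous_fun_ring T)"
    and surj: "carrier (continuous_fun_ring T) \<subseteq> e ` carrier R"
    and kernel: "\<lbrakk>maximalideal M R; a \<in> carrier R; \<And>t. t \<in> topspace T \<Longrightarrow> e a t = 0\<rbrakk> \<Longrightarrow> a \<in> M"
begin

lemma e_mult [simp]:
  "\<lbrakk>a \<in> carrier R; b \<in> carrier R; t \<in> topspace T\<rbrakk> \<Longrightarrow> e (a \<otimes> b) t = e a t * e b t"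
  using ring_hom_mult[OF hom] by (simp add: continuous_fun_ring_def)

lemma e_add [simp]:
  "\<lbrakk>a \<in> carrier R; b \<in> carrier R; t \<in> topspace T\<rbrakk> \<Longrightarrow> e (a \<oplus> b) t = e a t + e b t"
  using ring_hom_add[OF hom] by (simp add: continuous_fun_ring_def)

lemma e_one [simp]: "t \<in> topspace T \<Longrightarrow> e \<one> t = 1"
  using ring_hom_one[OF hom] by (simp add: continuous_fun_ring_def)

lemma e_zero [simp]:
  assumes "t \<in> topspace T" shows "e \<zero> t = 0"
  using e_add[of \<zero> \<zero> t] assms by simp

lemma e_minus [simp]:
  assumes "a \<in> carrier R" "t \<in> topspace T" shows "e (\<ominus> a) t = - e a t"
  using e_add[of "\<ominus> a" a t] assms by (simp add: l_neg)

lemma e_diff [simp]: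
  "\<lbrakk>a \<in> carrier R; b \<in> carrier R; t \<in> topspace T\<rbrakk> \<Longrightarrow> e (a \<ominus> b) t = e a t - e b t"
  by (simp add: a_minus_def)

lemma e_continuous: "a \<in> carrier R \<Longrightarrow> continuous_map T euclideanreal (e a)"
  using ring_hom_closed[OF hom] by (simp add: continuous_fun_ring_def)

lemma e_surj:
  assumes "continuous_map T euclideanreal f"
  obtains a where "a \<in> carrier R" "\<And>t. t \<in> topspace T \<Longrightarrow> e a t = f t"
proof -
  have "restrict f (topspace T) \<in> carrier (continuous_fun_ring T)"
    using assms by (auto simp: continuous_fun_ring_def intro: continuous_map_eq)
  then obtain a where "a \<in> carrier R" "e a = restrict f (topspace T)"
    using surj by (metis imageE subsetD)
  then show ?thesis using that by simp
qed

text \<open>Urysohn's lemma, transported to \<open>R\<close>; it provides both the injectivity and the openness of the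
  map from points to maximal ideals.\<close>

lemma separating_element:
  assumes "openin T U" "t \<in> U"
  obtains a where "a \<in> carrier R" "e a t \<noteq> 0" "\<And>s. s \<in> topspace T - U \<Longrightarrow> e a s = 0"
proof -
  have normal: "normal_space T"
    using compact Hausdorff by (simp add: compact_Hausdorff_or_regular_imp_normal_space)
  have "t \<in> topspace T" using assms openin_subset by blast
  then have t: "closedin T {t}" using Hausdorff by (simp add: closedin_Hausdorff_singleton)
  obtain f where f: "continuous_map T euclideanreal f"
      "f ` (topspace T - U) \<subseteq> {0}" "f ` {t} \<subseteq> {1}"
    by (rule Urysohn_lemma_alt[OF normal _ t, of "topspace T - U" 0 1])
       (use assms in \<open>auto simp: disjnt_def\<close>)
  obtain a where "a \<in> carrier R" "\<And>t. t \<in> topspace T \<Longrightarrow> e a t = f t"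
    using e_surj[OF f(1)] by blast
  then show ?thesis using f \<open>t \<in> topspace T\<close> by (intro that) auto
qed

definition point_ideal :: "'t \<Rightarrow> 'a set" where
  "point_ideal t = {a \<in> carrier R. e a t = 0}"

lemma ideal_point_ideal:
  assumes t: "t \<in> topspace T"
  shows "ideal (point_ideal t) R"
proof (rule idealI)
  show "subgroup (point_ideal t) (add_monoid R)"
    by (rule add.subgroupI) (use t in \<open>auto simp: point_ideal_def a_inv_def[symmetric] intro: exI[of _ \<zero>]\<close>)
qed (use t in \<open>auto simp: point_ideal_def ring_axioms\<close>)

text \<open>An element that does not vanish at \<open>t\<close> is invertible modulo the ideal: the constant
  function with the reciprocal value at \<open>t\<close> has a preimage under \<open>e\<close>.\<close>

lemma maximalideal_point_ideal:
  assumes t: "t \<in> topspace T"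
  shows "maximalideal (point_ideal t) R"
proof (rule maximalidealI)
  show "ideal (point_ideal t) R" using t by (rule ideal_point_ideal)
  have "\<one> \<notin> point_ideal t" using t by (simp add: point_ideal_def)
  then show "carrier R \<noteq> point_ideal t" by blast
next
  fix J assume J: "ideal J R" "point_ideal t \<subseteq> J" "J \<subseteq> carrier R"
  interpret J: ideal J R by (rule J)
  show "J = point_ideal t \<or> J = carrier R"
  proof (cases "J \<subseteq> point_ideal t")
    case False
    then obtain a where a: "a \<in> J" "a \<in> carrier R" "e a t \<noteq> 0"
      using J by (auto simp: point_ideal_def)
    obtain r where r: "r \<in> carrier R" "\<And>s. s \<in> topspace T \<Longrightarrow> e r s = inverse (e a t)"
      using e_surj[of "\<lambda>_. inverse (e a t)"] by auto
    have "\<one> \<ominus> r \<otimes> a \<in> J"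
      using J(2) a r t by (auto simp: point_ideal_def)
    moreover have "r \<otimes> a \<in> J" using a r J.I_l_closed by simp
    ultimately have "(\<one> \<ominus> r \<otimes> a) \<oplus> r \<otimes> a \<in> J" by (rule J.a_closed)
    moreover have "(\<one> \<ominus> r \<otimes> a) \<oplus> r \<otimes> a = \<one>" using a r by algebra
    ultimately show ?thesis using J.one_imp_carrier by simp
  qed (use J in auto)
qed

text \<open>Over the reals a sum of squares vanishes only where all summands do, so finitely many members
  of an ideal without a common zero yield a single member without zeros.\<close>

lemma sum_squares_in_ideal:
  assumes "ideal J R" "finite D" "\<And>s. s \<in> D \<Longrightarrow> c s \<in> J"
  shows "\<exists>b\<in>J. \<forall>t\<in>topspace T. e b t = (\<Sum>s\<in>D. (e (c s) t)\<^sup>2)"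
  using assms(2,3)
proof (induction D)
  case empty
  interpret ideal J R by (rule assms)
  show ?case using zero_closed by (auto intro!: bexI[of _ \<zero>])
next
  case (insert s D)
  interpret ideal J R by (rule assms)
  obtain b where b: "b \<in> J" "\<forall>t\<in>topspace T. e b t = (\<Sum>s\<in>D. (e (c s) t)\<^sup>2)"
    using insert by auto
  have s: "c s \<in> J" using insert by simp
  then have ss: "c s \<otimes> c s \<in> J" by (simp add: I_l_closed Icarr)
  show ?case
    using b s ss insert(1,2) Icarr
    by (intro bexI[of _ "c s \<otimes> c s \<oplus> b"]) (auto simp: power2_eq_square)
qed

text \<open>If no point annihilated \<open>M\<close>, then by compactness finitely many members of \<open>M\<close> would have no
  common zero; the sum of their squares would be a member without zeros, and the reciprocal of its
  image lifts to an inverse modulo the kernel of \<open>e\<close>, which lies in \<open>M\<close>.\<close>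

lemma maximalideal_imp_point_ideal:
  assumes M: "maximalideal M R"
  obtains t where "t \<in> topspace T" "M = point_ideal t"
proof -
  interpret M: maximalideal M R by (rule M)
  have "\<exists>t\<in>topspace T. M \<subseteq> point_ideal t"
  proof (rule ccontr)
    assume "\<not> ?thesis"
    then have "\<forall>t\<in>topspace T. \<exists>a\<in>M. e a t \<noteq> 0"
      using M.Icarr by (auto simp: point_ideal_def)
    then obtain c where c: "\<And>t. t \<in> topspace T \<Longrightarrow> c t \<in> M" "\<And>t. t \<in> topspace T \<Longrightarrow> e (c t) t \<noteq> 0"
      by metis
    define U where "U s = {t \<in> topspace T. e (c s) t \<in> - {0}}" for s
    have "openin T (U s)" if "s \<in> topspace T" for s
      unfolding U_def
      using c(1)[OF that] M.Icarr by (intro openin_continuous_map_preimage[OF e_continuous]) auto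
    moreover have "topspace T \<subseteq> \<Union> (U ` topspace T)"
      using c by (auto simp: U_def)
    ultimately obtain \<F> where "finite \<F>" "\<F> \<subseteq> U ` topspace T" "topspace T \<subseteq> \<Union>\<F>"
      using compact unfolding compact_space_alt by (metis (mono_tags, lifting) imageE)
    then obtain D where D: "finite D" "D \<subseteq> topspace T" "topspace T \<subseteq> (\<Union>s\<in>D. U s)"
      by (metis finite_subset_image)
    obtain b where b: "b \<in> M" "\<And>t. t \<in> topspace T \<Longrightarrow> e b t = (\<Sum>s\<in>D. (e (c s) t)\<^sup>2)"
      using sum_squares_in_ideal[OF M.is_ideal D(1), of c] c(1) D(2) by blast
    have pos: "e b t > 0" if t: "t \<in> topspace T" for t
    proof -
      obtain s where "s \<in> D" "e (c s) t \<noteq> 0" using D(3) t by (auto simp: U_def)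
      then have "0 < (\<Sum>s\<in>D. (e (c s) t)\<^sup>2)" using D(1) by (intro sum_pos2[of _ s]) auto
      then show ?thesis using b(2) t by simp
    qed
    have bR: "b \<in> carrier R" using b(1) by (rule M.Icarr)
    have "continuous_map T euclideanreal (\<lambda>t. inverse (e b t))"
      using pos e_continuous[OF bR] by (intro continuous_map_real_inverse) force+
    then obtain r where r: "r \<in> carrier R" "\<And>t. t \<in> topspace T \<Longrightarrow> e r t = inverse (e b t)"
      using e_surj by blast
    have "\<one> \<ominus> r \<otimes> b \<in> M"
    proof (rule kernel[OF M])
      fix t assume "t \<in> topspace T"
      then show "e (\<one> \<ominus> r \<otimes> b) t = 0" using r bR pos[of t] by simp
    qed (use r bR in simp)
    moreover have "r \<otimes> b \<in> M" using b(1) r(1) by (rule M.I_l_closed)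
    ultimately have "(\<one> \<ominus> r \<otimes> b) \<oplus> r \<otimes> b \<in> M" by (rule M.a_closed)
    moreover have "(\<one> \<ominus> r \<otimes> b) \<oplus> r \<otimes> b = \<one>" using bR r by algebra
    ultimately show False using M.one_imp_carrier M.I_notcarr by simp
  qed
  then obtain t where t: "t \<in> topspace T" "M \<subseteq> point_ideal t" by blast
  then have "point_ideal t = M \<or> point_ideal t = carrier R"
    using ideal_point_ideal by (intro M.I_maximal) (auto simp: point_ideal_def)
  moreover have "point_ideal t \<noteq> carrier R"
    using maximalideal.I_notcarr[OF maximalideal_point_ideal[OF t(1)]] by simp
  ultimately show ?thesis using that t(1) by blast
qed

lemma inj_on_point_ideal: "inj_on point_ideal (topspace T)"
proof (rule inj_onI, rule ccontr)
  fix s t assume st: "s \<in> topspace T" "t \<in> topspace T" "point_ideal s = point_ideal t" "s \<noteq> t"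
  have "openin T (topspace T - {s})"
    using Hausdorff st by (simp add: closedin_Hausdorff_singleton openin_diff)
  then obtain a where "a \<in> carrier R" "e a t \<noteq> 0"
      "\<And>r. r \<in> topspace T - (topspace T - {s}) \<Longrightarrow> e a r = 0"
    using separating_element[of "topspace T - {s}" t] st by blast
  then have "a \<in> point_ideal s" "a \<notin> point_ideal t"
    using st(1) by (simp_all add: point_ideal_def)
  then show False using st(3) by simp
qed

lemma image_point_ideal: "point_ideal ` topspace T = max_ideals R"
  unfolding max_ideals_def
  using maximalideal_point_ideal by (auto elim!: maximalideal_imp_point_ideal)

text \<open>A basic open set, given by \<open>E\<close>, pulls back to the union of the cozero sets of the functions
  from \<open>E\<close>. Conversely an open \<open>U\<close> is the union of the cozero sets of all functions that vanish off
  \<open>U\<close>, so its image is open.\<close>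

theorem homeomorphic_map_point_ideal: "homeomorphic_map T (max_spectrum R) point_ideal"
proof (rule bijective_open_imp_homeomorphic_map)
  show "continuous_map T (max_spectrum R) point_ideal"
    unfolding continuous_map_def
  proof (intro conjI allI impI)
    show "point_ideal \<in> topspace T \<rightarrow> topspace (max_spectrum R)"
      using image_point_ideal by (auto simp: topspace_max_spectrum)
    fix V assume "openin (max_spectrum R) V"
    then obtain E where E: "E \<subseteq> carrier R" "V = {M \<in> max_ideals R. \<not> E \<subseteq> M}"
      by (auto simp: openin_max_spectrum)
    have "{t \<in> topspace T. point_ideal t \<in> V} = (\<Union>a\<in>E. {t \<in> topspace T. e a t \<in> - {0}})"
      using E image_point_ideal by (auto simp: point_ideal_def)
    also have "openin T \<dots>"
    proof (intro openin_Union ballI, clarify)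
      fix a assume "a \<in> E"
      then show "openin T {t \<in> topspace T. e a t \<in> - {0}}"
        using E by (intro openin_continuous_map_preimage[OF e_continuous]) auto
    qed
    finally show "openin T {t \<in> topspace T. point_ideal t \<in> V}" .
  qed
  show "open_map T (max_spectrum R) point_ideal"
    unfolding open_map_def
  proof (intro allI impI)
    fix U assume U: "openin T U"
    define E where "E = {a \<in> carrier R. \<forall>s\<in>topspace T - U. e a s = 0}"
    have "E \<subseteq> carrier R" by (auto simp: E_def)
    have "point_ideal ` U = {M \<in> max_ideals R. \<not> E \<subseteq> M}"
    proof (intro equalityI subsetI)
      fix M assume "M \<in> point_ideal ` U"
      then obtain t where t: "t \<in> U" "M = point_ideal t" by blast
      obtain a where "a \<in> carrier R" "e a t \<noteq> 0" "\<And>s. s \<in> topspace T - U \<Longrightarrow> e a s = 0"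
        using separating_element[OF U t(1)] by blast
      then have "a \<in> E" "a \<notin> M" by (auto simp: E_def t point_ideal_def)
      moreover have "M \<in> max_ideals R"
        using t image_point_ideal openin_subset[OF U] by blast
      ultimately show "M \<in> {M \<in> max_ideals R. \<not> E \<subseteq> M}" by blast
    next
      fix M assume M: "M \<in> {M \<in> max_ideals R. \<not> E \<subseteq> M}"
      then obtain t where t: "t \<in> topspace T" "M = point_ideal t"
        using image_point_ideal by blast
      then have "t \<in> U" using M by (auto simp: E_def point_ideal_def)
      then show "M \<in> point_ideal ` U" using t by blast
    qed
    then show "openin (max_spectrum R) (point_ideal ` U)"
      unfolding openin_max_spectrum using \<open>E \<subseteq> carrier R\<close> by blast
  qed
qed (simp_all add: image_point_ideal topspace_max_spectrum inj_on_point_ideal)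

end


section \<open>Truncated polynomial rings\<close>

context cring
begin

lemma indexed_mult_var:
  assumes "carrier_coeff P"
  shows "indexed_mult P (indexed_var i) = P \<Otimes> i"
proof -
  have one: "carrier_coeff (indexed_const \<one>)" and var: "carrier_coeff (indexed_var i)"
    by (auto simp: carrier_coeff_def indexed_const_def indexed_var_def indexed_pmult_def)
  have "indexed_mult P (indexed_var i) = indexed_mult (indexed_var i) P"
    using assms var by (rule indexed_mult_commute)
  also have "\<dots> = indexed_mult (indexed_const \<one>) P \<Otimes> i"
    unfolding indexed_var_def using one assms by (rule indexed_mult_pmult)
  also have "\<dots> = P \<Otimes> i"
    using assms by (simp add: indexed_mult_const carrier_coeff_def)
  finally show ?thesis .
qed

lemma indexed_var_pow_coeff:
  fixes k :: nat
  assumes "i \<in> I" "count m i < k"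
  shows "(indexed_var i [^]\<^bsub>indexed_poly_ring R I\<^esub> k) m = \<zero>"
  using assms(2)
proof (induction k arbitrary: m)
  case (Suc k)
  interpret P: cring "indexed_poly_ring R I" by (rule cring_indexed_poly_ring)
  let ?p = "indexed_var i [^]\<^bsub>indexed_poly_ring R I\<^esub> k"
  have "?p \<in> carrier (indexed_poly_ring R I)"
    using assms(1) by (intro P.nat_pow_closed indexed_var_in_poly_ring)
  then have "carrier_coeff ?p"
    by (auto simp: indexed_poly_ring_def intro: indexed_pset_in_carrier[OF subset_refl])
  then have "indexed_var i [^]\<^bsub>indexed_poly_ring R I\<^esub> Suc k = ?p \<Otimes> i"
    using indexed_mult_var by (simp add: indexed_poly_ring_def)
  moreover have "count (m - {#i#}) i < k" if "i \<in># m"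
    using Suc.prems that by (auto simp: count_greater_zero_iff[symmetric] simp del: count_greater_zero_iff)
  ultimately show ?case
    using Suc.IH by (simp only: indexed_pmult_def) auto
qed simp

text \<open>If \<open>L\<close> is closed under divisors of monomials, each term of the convolution that computes a
  coefficient of \<open>P Q\<close> at a monomial of \<open>L\<close> has a factor that is a coefficient of \<open>P\<close> at a monomial
  of \<open>L\<close>.\<close>

lemma ideal_coeffs_vanish:
  assumes L: "\<And>m a. \<lbrakk>m \<in> L; a \<subseteq># m\<rbrakk> \<Longrightarrow> a \<in> L"
  shows "ideal {P \<in> carrier (indexed_poly_ring R I). \<forall>m\<in>L. P m = \<zero>} (indexed_poly_ring R I)"
    (is "ideal ?J ?P")
proof -
  interpret P: cring ?P by (rule cring_indexed_poly_ring)
  have cc: "P m \<in> carrier R" if "P \<in> carrier ?P" for P m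
    using that indexed_pset_in_carrier[OF subset_refl, of P I]
    by (simp add: indexed_poly_ring_def carrier_coeff_def)
  have add: "(P \<oplus>\<^bsub>?P\<^esub> Q) m = P m \<oplus> Q m" for P Q m
    by (simp add: indexed_poly_ring_def indexed_padd_def)
  have zero: "\<zero>\<^bsub>?P\<^esub> m = \<zero>" for m
    by (simp add: indexed_poly_ring_def indexed_zero_def)
  have mult: "(P \<otimes>\<^bsub>?P\<^esub> Q) m = \<zero>" if "P \<in> ?J" "Q \<in> carrier ?P" "m \<in> L" for P Q m
  proof -
    have "(P \<otimes>\<^bsub>?P\<^esub> Q) m = (\<Oplus>a\<in>{a. a \<subseteq># m}. P a \<otimes> Q (m - a))"
      by (simp add: indexed_poly_ring_def indexed_mult_def)
    also have "\<dots> = (\<Oplus>a\<in>{a. a \<subseteq># m}. \<zero>)"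
      using that L[OF that(3)] cc[OF that(2)] by (intro finsum_cong') auto
    finally show ?thesis by simp
  qed
  have neg: "(\<ominus>\<^bsub>?P\<^esub> P) m = \<ominus> (P m)" if "P \<in> carrier ?P" for P m
  proof -
    have "(\<ominus>\<^bsub>?P\<^esub> P) m \<oplus> P m = \<zero>"
      using P.l_neg[OF that] add[of "\<ominus>\<^bsub>?P\<^esub> P" P m] zero by simp
    then show ?thesis using that cc by (simp add: minus_equality)
  qed
  show ?thesis
  proof (rule idealI)
    show "subgroup ?J (add_monoid ?P)"
    proof (rule P.add.subgroupI)
      show "?J \<noteq> {}" using zero P.zero_closed by blast
    qed (auto simp: add neg a_inv_def[symmetric])
    show "Q \<otimes>\<^bsub>?P\<^esub> P \<in> ?J" if "P \<in> ?J" "Q \<in> carrier ?P" for P Q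
      using mult[of P Q] that by (auto simp: P.m_comm[of Q P])
  qed (use mult P.ring_axioms in auto)
qed

abbreviation truncation_ideal :: "'i set \<Rightarrow> ('i \<Rightarrow> nat) \<Rightarrow> ('i multiset \<Rightarrow> 'a) set" where
  "truncation_ideal I n \<equiv>
    Idl\<^bsub>indexed_poly_ring R I\<^esub> ((\<lambda>i. indexed_var i [^]\<^bsub>indexed_poly_ring R I\<^esub> n i) ` I)"

lemma truncated_poly_ring_eq:
  "truncated_poly_ring R I n = indexed_poly_ring R I Quot truncation_ideal I n"
  by (simp add: truncated_poly_ring_def Let_def)

lemma var_pow_in_poly_ring:
  "(\<lambda>i. indexed_var i [^]\<^bsub>indexed_poly_ring R I\<^esub> (n i :: nat)) ` I \<subseteq> carrier (indexed_poly_ring R I)"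
proof -
  interpret P: cring "indexed_poly_ring R I" by (rule cring_indexed_poly_ring)
  show ?thesis by (auto intro: P.nat_pow_closed indexed_var_in_poly_ring)
qed

lemma ideal_truncation_ideal: "ideal (truncation_ideal I n) (indexed_poly_ring R I)"
proof -
  interpret P: cring "indexed_poly_ring R I" by (rule cring_indexed_poly_ring)
  show ?thesis by (intro P.genideal_ideal var_pow_in_poly_ring)
qed

text \<open>The monomials with all exponents below the bounds form a set closed under divisors, and none
  of them occurs in a generator. Applied to a single variable this shows that the variable survives in the
  quotient; applied to the empty monomial, that the constant coefficient descends to it.\<close>

lemma truncation_ideal_coeff:
  assumes "P \<in> truncation_ideal I n" "\<And>i. i \<in> I \<Longrightarrow> count m i < n i"
  shows "P m = \<zero>"
proof -
  let ?L = "{m. \<forall>i\<in>I. count m i < n i}"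
  let ?J = "{P \<in> carrier (indexed_poly_ring R I). \<forall>m\<in>?L. P m = \<zero>}"
  interpret P: cring "indexed_poly_ring R I" by (rule cring_indexed_poly_ring)
  have "ideal ?J (indexed_poly_ring R I)"
    by (rule ideal_coeffs_vanish) (auto intro: le_less_trans mset_subset_eq_count)
  moreover have "(\<lambda>i. indexed_var i [^]\<^bsub>indexed_poly_ring R I\<^esub> n i) ` I \<subseteq> ?J"
    using var_pow_in_poly_ring[of I n] by (auto intro: indexed_var_pow_coeff)
  ultimately have "truncation_ideal I n \<subseteq> ?J" by (rule P.genideal_minimal)
  then show ?thesis using assms by auto
qed

lemma nilpotent_in_truncated_poly_ring:
  assumes "\<one> \<noteq> \<zero>" "\<And>i. i \<in> I \<Longrightarrow> 1 < n i" "i \<in> I"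
  obtains x where "x \<in> carrier (truncated_poly_ring R I n)"
    "x \<noteq> \<zero>\<^bsub>truncated_poly_ring R I n\<^esub>"
    "x [^]\<^bsub>truncated_poly_ring R I n\<^esub> n i = \<zero>\<^bsub>truncated_poly_ring R I n\<^esub>"
proof -
  let ?P = "indexed_poly_ring R I" and ?I = "truncation_ideal I n"
  interpret P: cring ?P by (rule cring_indexed_poly_ring)
  interpret I: ideal ?I ?P by (rule ideal_truncation_ideal)
  interpret q: ring_hom_ring ?P "?P Quot ?I" "(+>\<^bsub>?P\<^esub>) ?I" by (rule I.rcos_ring_hom_ring)
  have var: "indexed_var i \<in> carrier ?P" using assms(3) by (rule indexed_var_in_poly_ring)
  have zero: "\<zero>\<^bsub>truncated_poly_ring R I n\<^esub> = ?I"
    unfolding truncated_poly_ring_eq FactRing_def by simp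
  show ?thesis
  proof
    show "?I +>\<^bsub>?P\<^esub> indexed_var i \<in> carrier (truncated_poly_ring R I n)"
      using var unfolding truncated_poly_ring_eq by simp
    have "indexed_var i {#i#} \<noteq> \<zero>"
      using assms(1) by (simp add: indexed_var_def indexed_pmult_def indexed_const_def)
    moreover have "count {#i#} j < n j" if "j \<in> I" for j
      using assms(2)[OF that] by simp
    ultimately have "indexed_var i \<notin> ?I"
      using truncation_ideal_coeff by blast
    then show "?I +>\<^bsub>?P\<^esub> indexed_var i \<noteq> \<zero>\<^bsub>truncated_poly_ring R I n\<^esub>"
      unfolding zero using I.rcos_const_imp_mem[OF var] by blast
    have "indexed_var i [^]\<^bsub>?P\<^esub> n i \<in> ?I"
      using P.genideal_self[OF var_pow_in_poly_ring] assms(3) by blast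
    then have "?I +>\<^bsub>?P\<^esub> (indexed_var i [^]\<^bsub>?P\<^esub> n i) = ?I"
      by (rule I.a_rcos_const)
    then show "(?I +>\<^bsub>?P\<^esub> indexed_var i) [^]\<^bsub>truncated_poly_ring R I n\<^esub> n i
        = \<zero>\<^bsub>truncated_poly_ring R I n\<^esub>"
      unfolding zero unfolding truncated_poly_ring_eq
      by (simp only: q.hom_nat_pow[OF var, symmetric])
  qed
qed

text \<open>A polynomial is built from constants by sums and by multiplication with variables, and each of
  these steps respects congruence to the constant term modulo an ideal that contains the variables.\<close>

lemma indexed_poly_decompose:
  assumes J: "ideal J (indexed_poly_ring R I)" and vars: "\<And>i. i \<in> I \<Longrightarrow> indexed_var i \<in> J"
    and P: "P \<in> carrier (indexed_poly_ring R I)"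
  obtains Q where "Q \<in> J" "P = indexed_const (P {#}) \<oplus>\<^bsub>indexed_poly_ring R I\<^esub> Q"
proof -
  let ?P = "indexed_poly_ring R I"
  interpret P: cring ?P by (rule cring_indexed_poly_ring)
  interpret J: ideal J ?P by (rule J)
  note cc = indexed_pset_in_carrier[OF subset_refl, where I = I]
  have const: "indexed_const k \<in> carrier ?P" if "k \<in> carrier R" for k
    using that by (simp add: indexed_poly_ring_def indexed_pset.indexed_const)
  have "P \<in> ((carrier R)[\<X>\<^bsub>I\<^esub>])" using P by (simp add: indexed_poly_ring_def)
  then have "\<exists>Q\<in>J. P = indexed_const (P {#}) \<oplus>\<^bsub>?P\<^esub> Q"
  proof (induction)
    case (indexed_const k)
    then show ?case
      using const[of k] J.zero_closed by (intro bexI[of _ "\<zero>\<^bsub>?P\<^esub>"]) (auto simp: indexed_const_def)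
  next
    case (indexed_padd P P')
    then obtain Q Q' where Q: "Q \<in> J" "P = indexed_const (P {#}) \<oplus>\<^bsub>?P\<^esub> Q"
      "Q' \<in> J" "P' = indexed_const (P' {#}) \<oplus>\<^bsub>?P\<^esub> Q'" by blast
    have c: "P {#} \<in> carrier R" "P' {#} \<in> carrier R"
      using indexed_padd(1,2)[THEN cc] by (auto simp: carrier_coeff_def)
    have "P \<Oplus> P' = P \<oplus>\<^bsub>?P\<^esub> P'" by (simp add: indexed_poly_ring_def)
    also have "\<dots> = (indexed_const (P {#}) \<oplus>\<^bsub>?P\<^esub> Q) \<oplus>\<^bsub>?P\<^esub> (indexed_const (P' {#}) \<oplus>\<^bsub>?P\<^esub> Q')"
      using Q(2,4) by simp
    also have "\<dots> = (indexed_const (P {#}) \<oplus>\<^bsub>?P\<^esub> indexed_const (P' {#})) \<oplus>\<^bsub>?P\<^esub> (Q \<oplus>\<^bsub>?P\<^esub> Q')"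
      using const[OF c(1)] const[OF c(2)] J.Icarr[OF Q(1)] J.Icarr[OF Q(3)]
      by (simp add: P.a_ac)
    also have "indexed_const (P {#}) \<oplus>\<^bsub>?P\<^esub> indexed_const (P' {#}) = indexed_const ((P \<Oplus> P') {#})"
      using c by (auto simp: indexed_poly_ring_def indexed_padd_def indexed_const_def)
    finally show ?case using J.a_closed[OF Q(1,3)] by blast
  next
    case (indexed_pmult P i)
    have "P \<Otimes> i = P \<otimes>\<^bsub>?P\<^esub> indexed_var i"
      using indexed_mult_var[OF cc[OF indexed_pmult(1)]] by (simp add: indexed_poly_ring_def)
    also have "\<dots> \<in> J"
      using vars[OF indexed_pmult(2)] indexed_pmult(1)
      by (intro J.I_l_closed) (auto simp: indexed_poly_ring_def)
    finally have mem: "P \<Otimes> i \<in> J" .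
    moreover have "indexed_const ((P \<Otimes> i) {#}) = \<zero>\<^bsub>?P\<^esub>"
      by (simp add: indexed_pmult_def indexed_poly_ring_def)
    ultimately show ?case using J.Icarr[OF mem] by (metis P.l_zero)
  qed
  then show ?thesis using that by blast
qed

lemma const_coeff_hom: "(\<lambda>P. P {#}) \<in> ring_hom (indexed_poly_ring R I) R"
proof (rule ring_hom_memI)
  have cc: "P {#} \<in> carrier R" if "P \<in> carrier (indexed_poly_ring R I)" for P
    using that indexed_pset_in_carrier[OF subset_refl, of P I]
    by (simp add: indexed_poly_ring_def carrier_coeff_def)
  then show "P {#} \<in> carrier R" if "P \<in> carrier (indexed_poly_ring R I)" for P
    using that by simp
  show "(P \<otimes>\<^bsub>indexed_poly_ring R I\<^esub> Q) {#} = P {#} \<otimes> Q {#}"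
    if "P \<in> carrier (indexed_poly_ring R I)" "Q \<in> carrier (indexed_poly_ring R I)" for P Q
    using that[THEN cc] by (simp add: indexed_poly_ring_def indexed_mult_def)
qed (simp_all add: indexed_poly_ring_def indexed_padd_def indexed_const_def)

end

text \<open>The argument is meant to be a coset all of whose members have the same constant
  coefficient; otherwise the value is unspecified.\<close>

definition const_coeff :: "('i multiset \<Rightarrow> 'a) set \<Rightarrow> 'a" where
  "const_coeff C = the_elem ((\<lambda>P. P {#}) ` C)"

lemma (in primeideal) nat_pow_in_primeD:
  assumes "x \<in> carrier R" "x [^] (k::nat) \<in> I"
  shows "x \<in> I"
  using assms(2)
proof (induction k)
  case 0
  then show ?case using one_imp_carrier I_notcarr by simp
next
  case (Suc k)
  then show ?case using I_prime[of "x [^] k" x] assms(1) by auto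
qed

context cring
begin

lemma const_coeff_rcos:
  assumes "\<And>i. i \<in> I \<Longrightarrow> 0 < n i" "P \<in> carrier (indexed_poly_ring R I)"
  shows "const_coeff (truncation_ideal I n +>\<^bsub>indexed_poly_ring R I\<^esub> P) = P {#}"
proof -
  let ?P = "indexed_poly_ring R I" and ?I = "truncation_ideal I n"
  interpret I: ideal ?I ?P by (rule ideal_truncation_ideal)
  have P0: "P {#} \<in> carrier R" using assms(2) const_coeff_hom by (rule ring_hom_closed[rotated])
  have "Q {#} = P {#}" if Q: "Q \<in> ?I +>\<^bsub>?P\<^esub> P" for Q
  proof -
    obtain Z where "Z \<in> ?I" "Q = Z \<oplus>\<^bsub>?P\<^esub> P"
      using Q by (auto simp: a_r_coset_def')
    moreover have "Z {#} = \<zero>" using \<open>Z \<in> ?I\<close> assms(1) by (intro truncation_ideal_coeff) auto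
    ultimately show ?thesis using P0 by (simp add: indexed_poly_ring_def indexed_padd_def)
  qed
  moreover have "P \<in> ?I +>\<^bsub>?P\<^esub> P" using assms(2) by (rule I.a_rcos_self)
  ultimately have "(\<lambda>P. P {#}) ` (?I +>\<^bsub>?P\<^esub> P) = {P {#}}" by blast
  then show ?thesis by (simp add: const_coeff_def)
qed

lemma carrier_truncated_poly_ringE:
  assumes "a \<in> carrier (truncated_poly_ring R I n)"
  obtains P where "P \<in> carrier (indexed_poly_ring R I)"
    "a = truncation_ideal I n +>\<^bsub>indexed_poly_ring R I\<^esub> P"
  using assms unfolding truncated_poly_ring_eq FactRing_def A_RCOSETS_def' a_r_coset_def'
  by auto

lemma const_coeff_truncated_hom:
  assumes pos: "\<And>i. i \<in> I \<Longrightarrow> 0 < n i"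
  shows "const_coeff \<in> ring_hom (truncated_poly_ring R I n) R"
proof -
  let ?P = "indexed_poly_ring R I" and ?A = "truncated_poly_ring R I n"
  let ?q = "(+>\<^bsub>?P\<^esub>) (truncation_ideal I n)"
  interpret P: cring ?P by (rule cring_indexed_poly_ring)
  interpret q: ring_hom_ring ?P ?A ?q
    unfolding truncated_poly_ring_eq by (rule ideal.rcos_ring_hom_ring[OF ideal_truncation_ideal])
  note val = const_coeff_rcos[where I = I and n = n, OF pos]
  note c = ring_hom_memE[OF const_coeff_hom[of I]]
  show ?thesis
  proof (rule ring_hom_memI)
    fix a assume "a \<in> carrier ?A"
    then obtain P where P: "P \<in> carrier ?P" "a = ?q P" by (rule carrier_truncated_poly_ringE)
    then show "const_coeff a \<in> carrier R" using val c(1) by simp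
    fix b assume "b \<in> carrier ?A"
    then obtain Q where Q: "Q \<in> carrier ?P" "b = ?q Q" by (rule carrier_truncated_poly_ringE)
    have "const_coeff (a \<otimes>\<^bsub>?A\<^esub> b) = const_coeff (?q (P \<otimes>\<^bsub>?P\<^esub> Q))"
      using P Q by simp
    also have "\<dots> = const_coeff a \<otimes> const_coeff b"
      using P Q by (simp add: val c del: q.hom_mult)
    finally show "const_coeff (a \<otimes>\<^bsub>?A\<^esub> b) = const_coeff a \<otimes> const_coeff b" .
    have "const_coeff (a \<oplus>\<^bsub>?A\<^esub> b) = const_coeff (?q (P \<oplus>\<^bsub>?P\<^esub> Q))"
      using P Q by simp
    also have "\<dots> = const_coeff a \<oplus> const_coeff b"
      using P Q by (simp add: val c del: q.hom_add)
    finally show "const_coeff (a \<oplus>\<^bsub>?A\<^esub> b) = const_coeff a \<oplus> const_coeff b" .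
  next
    have "const_coeff (?q \<one>\<^bsub>?P\<^esub>) = \<one>" using c(4) by (simp add: val del: q.hom_one)
    then show "const_coeff \<one>\<^bsub>?A\<^esub> = \<one>" by simp
  qed
qed

lemma const_coeff_surj:
  assumes pos: "\<And>i. i \<in> I \<Longrightarrow> 0 < n i"
  shows "carrier R \<subseteq> const_coeff ` carrier (truncated_poly_ring R I n)"
proof
  let ?P = "indexed_poly_ring R I"
  interpret q: ring_hom_ring ?P "truncated_poly_ring R I n" "(+>\<^bsub>?P\<^esub>) (truncation_ideal I n)"
    unfolding truncated_poly_ring_eq by (rule ideal.rcos_ring_hom_ring[OF ideal_truncation_ideal])
  fix k assume "k \<in> carrier R"
  then have "indexed_const k \<in> carrier ?P"
    by (simp add: indexed_poly_ring_def indexed_pset.indexed_const)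
  then show "k \<in> const_coeff ` carrier (truncated_poly_ring R I n)"
    using const_coeff_rcos[of I n "indexed_const k"] pos q.hom_closed
    by (intro image_eqI[of _ _ "truncation_ideal I n +>\<^bsub>?P\<^esub> indexed_const k"])
       (auto simp: indexed_const_def)
qed

text \<open>The preimage of a prime ideal in the polynomial ring contains a power of each variable, hence
  the variable itself, hence every polynomial without constant term.\<close>

lemma const_coeff_kernel_in_prime:
  assumes pos: "\<And>i. i \<in> I \<Longrightarrow> 0 < n i" and M: "primeideal M (truncated_poly_ring R I n)"
    and a: "a \<in> carrier (truncated_poly_ring R I n)" "const_coeff a = \<zero>"
  shows "a \<in> M"
proof -
  let ?P = "indexed_poly_ring R I" and ?I = "truncation_ideal I n"
  let ?A = "truncated_poly_ring R I n"
  let ?q = "(+>\<^bsub>?P\<^esub>) ?I"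
  interpret P: cring ?P by (rule cring_indexed_poly_ring)
  interpret I: ideal ?I ?P by (rule ideal_truncation_ideal)
  interpret M: primeideal M ?A by (rule M)
  interpret q: ring_hom_ring ?P ?A ?q
    unfolding truncated_poly_ring_eq by (rule I.rcos_ring_hom_ring)
  define J where "J = {P \<in> carrier ?P. ?q P \<in> M}"
  have J: "ideal J ?P"
    unfolding J_def by (rule q.ideal_vimage[OF M.is_ideal])
  have vars: "indexed_var i \<in> J" if i: "i \<in> I" for i
  proof -
    have var: "indexed_var i \<in> carrier ?P" using i by (rule indexed_var_in_poly_ring)
    have "indexed_var i [^]\<^bsub>?P\<^esub> n i \<in> ?I"
      using P.genideal_self[OF var_pow_in_poly_ring] i by blast
    then have "?q (indexed_var i [^]\<^bsub>?P\<^esub> n i) = ?I"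
      by (rule I.a_rcos_const)
    also have "\<dots> = \<zero>\<^bsub>?A\<^esub>"
      unfolding truncated_poly_ring_eq FactRing_def by simp
    finally have "?q (indexed_var i) [^]\<^bsub>?A\<^esub> n i = \<zero>\<^bsub>?A\<^esub>"
      by (simp only: q.hom_nat_pow[OF var])
    then have "?q (indexed_var i) [^]\<^bsub>?A\<^esub> n i \<in> M"
      using additive_subgroup.zero_closed[OF ideal.axioms(1)[OF M.is_ideal]] by (simp only:)
    then have "?q (indexed_var i) \<in> M"
      using q.hom_closed[OF var] by (rule M.nat_pow_in_primeD[rotated])
    then show ?thesis using var unfolding J_def by blast
  qed
  obtain P where P: "P \<in> carrier ?P" "a = ?q P" using a(1) by (rule carrier_truncated_poly_ringE)
  have "P {#} = \<zero>" using a(2) P const_coeff_rcos[of I n P] pos by simp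
  moreover obtain Q where Q: "Q \<in> J" "P = indexed_const (P {#}) \<oplus>\<^bsub>?P\<^esub> Q"
    using indexed_poly_decompose[OF J vars P(1)] by blast
  moreover have "indexed_const \<zero> = \<zero>\<^bsub>?P\<^esub>" by (simp add: indexed_poly_ring_def)
  moreover have "Q \<in> carrier ?P" using Q(1) by (simp add: J_def)
  ultimately have "P = Q" by simp
  then show ?thesis using Q(1) P(2) by (simp add: J_def)
qed

end


section \<open>The maximal spectrum of the truncated polynomial ring\<close>

theorem theorem5p1:
  fixes T :: "'t topology" and \<Delta> :: "'d set" and n :: "'d \<Rightarrow> nat"
    and A :: "('d multiset \<Rightarrow> 't \<Rightarrow> real) set ring"
  assumes "topspace T \<noteq> {}" and "path_connected_space T"
    and "compact_space T" and "Hausdorff_space T"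
    and "\<And>\<delta>. \<delta> \<in> \<Delta> \<Longrightarrow> 1 < n \<delta>"
  defines "A \<equiv> truncated_poly_ring (continuous_fun_ring T) \<Delta> n"
  shows "(\<Delta> \<noteq> {} \<longrightarrow>
           (\<forall>(F :: 'f ring) (Y :: 'x set) S.
              field F \<and> char_zero F \<and> function_ring F Y S \<longrightarrow> \<not> ring_embeds A S))
       \<and> topspace (max_spectrum A) \<noteq> {}
       \<and> path_connected_space (max_spectrum A)
       \<and> compact_space (max_spectrum A)
       \<and> Hausdorff_space (max_spectrum A)
       \<and> ((\<exists>s\<in>topspace T. \<exists>t\<in>topspace T. s \<noteq> t) \<longrightarrow>
            (\<exists>M\<in>max_ideals A. \<exists>N\<in>max_ideals A. M \<noteq> N))"
proof -
  let ?C = "continuous_fun_ring T"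
  interpret C: cring ?C by (rule cring_continuous_fun_ring)
  have cA: "cring A" unfolding A_def by (rule C.cring_truncated_poly_ring)
  interpret A: cring A by (rule cA)
  have pos: "0 < n \<delta>" if "\<delta> \<in> \<Delta>" for \<delta> using assms(5)[OF that] by simp
  have nonembed: "\<not> ring_embeds A S"
    if \<Delta>: "\<Delta> \<noteq> {}" and F: "field F" and S: "function_ring F Y S"
    for F :: "'f ring" and Y :: "'x set" and S
  proof
    assume emb: "ring_embeds A S"
    obtain \<delta> where \<delta>: "\<delta> \<in> \<Delta>" using \<Delta> by blast
    obtain t where "t \<in> topspace T" using assms(1) by (meson ex_in_conv)
    then have "\<one>\<^bsub>?C\<^esub> t \<noteq> \<zero>\<^bsub>?C\<^esub> t" by (simp add: continuous_fun_ring_def)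
    then have "\<one>\<^bsub>?C\<^esub> \<noteq> \<zero>\<^bsub>?C\<^esub>" by metis
    then obtain x where x: "x \<in> carrier A" "x \<noteq> \<zero>\<^bsub>A\<^esub>" "x [^]\<^bsub>A\<^esub> n \<delta> = \<zero>\<^bsub>A\<^esub>"
      unfolding A_def using C.nilpotent_in_truncated_poly_ring[of \<Delta> n \<delta>] assms(5) \<delta> by blast
    have "domain F" using F by (rule field.axioms(1))
    then have "x = \<zero>\<^bsub>A\<^esub>"
      using S A.ring_axioms emb x(1,3) by (rule nilpotent_eq_zero_of_embeds)
    then show False using x(2) by contradiction
  qed
  interpret continuous_fun_quotient A T const_coeff
  proof (intro continuous_fun_quotient.intro continuous_fun_quotient_axioms.intro cA assms(3,4))
    show "const_coeff \<in> ring_hom A ?C"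
      unfolding A_def using pos by (rule C.const_coeff_truncated_hom)
    show "carrier ?C \<subseteq> const_coeff ` carrier A"
      unfolding A_def using pos by (rule C.const_coeff_surj)
    fix M a
    assume M: "maximalideal M A" and a: "a \<in> carrier A" "\<And>t. t \<in> topspace T \<Longrightarrow> const_coeff a t = 0"
    have "const_coeff a \<in> carrier ?C"
      using \<open>const_coeff \<in> ring_hom A ?C\<close> a(1) by (rule ring_hom_closed)
    then have "const_coeff a = \<zero>\<^bsub>?C\<^esub>"
      using a(2) by (auto simp: continuous_fun_ring_def extensional_def fun_eq_iff)
    then show "a \<in> M"
      using C.const_coeff_kernel_in_prime[of \<Delta> n M a] pos a(1) A.maximalideal_prime[OF M]
      by (simp add: A_def)
  qed
  have homeo: "T homeomorphic_space max_spectrum A"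
    using homeomorphic_map_point_ideal by (rule homeomorphic_map_imp_homeomorphic_space)
  have "\<Delta> \<noteq> {} \<longrightarrow> (\<forall>(F :: 'f ring) (Y :: 'x set) S.
      field F \<and> char_zero F \<and> function_ring F Y S \<longrightarrow> \<not> ring_embeds A S)"
    by (intro impI allI) (elim conjE, rule nonembed)
  moreover have "topspace (max_spectrum A) \<noteq> {}"
    unfolding A.topspace_max_spectrum image_point_ideal[symmetric] image_is_empty by (rule assms(1))
  moreover have "path_connected_space (max_spectrum A)"
    using homeo assms(2) by (simp add: homeomorphic_path_connected_space)
  moreover have "compact_space (max_spectrum A)"
    using homeo assms(3) by (simp add: homeomorphic_compact_space)
  moreover have "Hausdorff_space (max_spectrum A)"
    using homeo assms(4) by (simp add: homeomorphic_Hausdorff_space)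
  moreover have "(\<exists>s\<in>topspace T. \<exists>t\<in>topspace T. s \<noteq> t) \<longrightarrow>
      (\<exists>M\<in>max_ideals A. \<exists>N\<in>max_ideals A. M \<noteq> N)"
  proof
    assume "\<exists>s\<in>topspace T. \<exists>t\<in>topspace T. s \<noteq> t"
    then obtain s t where st: "s \<in> topspace T" "t \<in> topspace T" "s \<noteq> t" by blast
    then have "point_ideal s \<noteq> point_ideal t" using inj_on_point_ideal by (meson inj_onD)
    moreover have "point_ideal s \<in> max_ideals A" "point_ideal t \<in> max_ideals A"
      unfolding image_point_ideal[symmetric] by (rule imageI[OF st(1)], rule imageI[OF st(2)])
    ultimately show "\<exists>M\<in>max_ideals A. \<exists>N\<in>max_ideals A. M \<noteq> N" by blast
  qed
  ultimately show ?thesis by (intro conjI)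
qed

end
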